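(* Let $\lambda,a_1,a_2,b_1,b_2$ be nonnegative real numbers with $a_1(b_1+b_2)\geq b_1a_2$. Define $T_{n,k}$ by $T_{0,0}=1$, $T_{n,k}=0$ unless $0\le k\le n$, and for $n\ge1$ $$T_{n,k}=(b_1k+b_2)T_{n-1,k-1}+[(2\lambda b_1+a_1)k+a_2+\lambda(b_1+b_2)]T_{n-1,k}+\lambda(a_1+\lambda b_1)(k+1)T_{n-1,k+1},$$ and let $T_n(x)=\sum_{k\ge0}T_{n,k}x^k$. Then: (i) for every $n\geq1$, $T_n(x)$ has only simple real zeros, all lying in the open interval $(-\lambda-\frac{a_1}{b_1},-\lambda)$ (where $-\lambda-\frac{a_1}{b_1}$ is interpreted as $-\infty$ when $b_1=0$), and $T_{n-1}(x)$ interlaces $T_n(x)$; consequently the coefficient sequence $(T_{n,k})_{k\ge0}$ is log-concave for $n\geq1$; (ii) for every $n\geq1$, the Turán-type polynomial $T_{n+1}(x)T_{n-1}(x)-(T_n(x))^2$ is weakly stable.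
   Context: For real-rooted polynomials $f,g$ with $\deg f=\deg g+1=n$, zeros $r_1\ge r_2\ge\cdots\ge r_n$ of $f$ and $s_1\ge\cdots\ge s_{n-1}$ of $g$, one says $g$ interlaces $f$ if $r_n\le s_{n-1}\le r_{n-1}\le\cdots\le s_2\le r_2\le s_1\le r_1$. A sequence $(c_k)_{k\ge0}$ of nonnegative numbers is log-concave if $c_{k-1}c_{k+1}\le c_k^2$ for all $k\ge1$. A real polynomial is weakly (Hurwitz) stable if all its zeros lie in the closed left half of the complex plane.
   Formalization: Simplicity is claimed only for a_1>0; zeros may also equal -λ if a_2=0, or -λ-a_1/b_1 if a_1(b_1+b_2)=b_1a_2; the zero and interlacing claims assume b_1+b_2>0; (ii) assumes b_1+b_2>0 and not a_1=b_1=0. In the excluded cases the original claims fail. *)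

theory Defs
  imports Complex_Main "HOL-Computational_Algebra.Computational_Algebra"
    "HOL-Library.Extended_Real"
begin

primrec T :: "real \<Rightarrow> real \<Rightarrow> real \<Rightarrow> real \<Rightarrow> real \<Rightarrow> nat \<Rightarrow> int \<Rightarrow> real" where
  "T lam a1 a2 b1 b2 0 k = (if k = 0 then 1 else 0)"
| "T lam a1 a2 b1 b2 (Suc n) k =
     (if 0 \<le> k \<and> k \<le> int (Suc n) then
        (b1 * of_int k + b2) * T lam a1 a2 b1 b2 n (k - 1)
        + ((2 * lam * b1 + a1) * of_int k + a2 + lam * (b1 + b2)) * T lam a1 a2 b1 b2 n k
        + lam * (a1 + lam * b1) * (of_int k + 1) * T lam a1 a2 b1 b2 n (k + 1)
      else 0)"

definition T_poly :: "real \<Rightarrow> real \<Rightarrow> real \<Rightarrow> real \<Rightarrow> real \<Rightarrow> nat \<Rightarrow> real poly" where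
  "T_poly lam a1 a2 b1 b2 n = (\<Sum>k\<le>n. monom (T lam a1 a2 b1 b2 n (int k)) k)"

text \<open>Nonzero constants are real-rooted (they have no zeros); the zero polynomial, which
  vanishes at every complex number, is not.\<close>

definition real_rooted :: "real poly \<Rightarrow> bool" where
  "real_rooted p \<longleftrightarrow> (\<forall>z. poly (map_poly complex_of_real p) z = 0 \<longrightarrow> z \<in> \<real>)"

definition simple_zeros :: "real poly \<Rightarrow> bool" where
  "simple_zeros p \<longleftrightarrow> (\<forall>z. poly (map_poly complex_of_real p) z = 0 \<longrightarrow>
     order z (map_poly complex_of_real p) = 1)"

text \<open>The real zeros of a polynomial, listed with multiplicity in weakly decreasing order.
  List positions start at 0, so position \<open>i\<close> holds $r_{i+1}$.\<close>

definition zeros_desc :: "real poly \<Rightarrow> real list" where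
  "zeros_desc p = rev (sorted_list_of_multiset (proots p))"

definition interlaces :: "real poly \<Rightarrow> real poly \<Rightarrow> bool" where
  "interlaces g f \<longleftrightarrow> real_rooted f \<and> real_rooted g \<and> degree f = degree g + 1 \<and>
     (\<forall>i<degree g. zeros_desc f ! (i + 1) \<le> zeros_desc g ! i \<and>
                   zeros_desc g ! i \<le> zeros_desc f ! i)"

definition log_concave :: "(nat \<Rightarrow> real) \<Rightarrow> bool" where
  "log_concave c \<longleftrightarrow> (\<forall>k. 0 \<le> c k) \<and> (\<forall>k\<ge>1. c (k - 1) * c (k + 1) \<le> (c k)\<^sup>2)"

text \<open>The zero polynomial is not weakly stable in this sense.\<close>

definition weakly_stable :: "real poly \<Rightarrow> bool" where
  "weakly_stable p \<longleftrightarrow> (\<forall>z. poly (map_poly complex_of_real p) z = 0 \<longrightarrow> Re z \<le> 0)"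

definition left_end :: "real \<Rightarrow> real \<Rightarrow> real \<Rightarrow> ereal" where
  "left_end lam a1 b1 = (if b1 = 0 then - \<infinity> else ereal (- lam - a1 / b1))"

end

theory Submission
  imports Defs
begin

text \<open>
  Put \<open>A = (x + lam) (b1 (x + lam) + a1)\<close> and \<open>B = (b1 + b2) (x + lam) + a2\<close>. The recurrence reads
  \<open>T\<^sub>n\<^sub>+\<^sub>1 = A T\<^sub>n' + B T\<^sub>n\<close>. If \<open>T\<^sub>n\<close> has simple real zeros \<open>s\<close> in the interval, where \<open>A \<le> 0\<close>,
  then partial fractions give
  \<open>T\<^sub>n\<^sub>+\<^sub>1 / T\<^sub>n = \<alpha> z + \<beta> + \<Sum> A(s) / (z - s)\<close> with \<open>\<alpha> > 0\<close>.
  The imaginary part of this quotient has the sign of \<open>Im z\<close>, so the zeros of \<open>T\<^sub>n\<^sub>+\<^sub>1\<close> are real;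
  its derivative is positive on the real line, which yields simplicity and interlacing. Common zeros
  of \<open>T\<^sub>n\<close> and \<open>T\<^sub>n\<^sub>+\<^sub>1\<close> are end points of the interval; there \<open>A(s) = 0\<close> and the pole
  disappears. Finally \<open>T\<^sub>n\<^sub>+\<^sub>2 T\<^sub>n - T\<^sub>n\<^sub>+\<^sub>1\<^sup>2 = A T\<^sub>n\<^sup>2 (T\<^sub>n\<^sub>+\<^sub>1 / T\<^sub>n)'\<close>, and for
  \<open>Re z > - lam\<close> off the real line the terms \<open>- A(s) / (z - s)\<^sup>2\<close> of the derivative have imaginary
  parts of one and the same sign. For \<open>a1 = 0\<close> all polynomials are powers of one linear factor.
\<close>

subsection \<open>Real polynomials with simple real zeros\<close>

lemma map_poly_of_real_add:
  "map_poly of_real (p + q) = (map_poly of_real p + map_poly of_real q :: 'a::real_normed_field poly)"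
  by (intro poly_eqI) (simp add: coeff_map_poly)

lemma map_poly_of_real_diff:
  "map_poly of_real (p - q) = (map_poly of_real p - map_poly of_real q :: 'a::real_normed_field poly)"
  by (intro poly_eqI) (simp add: coeff_map_poly)

lemma map_poly_of_real_smult:
  "map_poly of_real (smult c p) = (smult (of_real c) (map_poly of_real p) :: 'a::real_normed_field poly)"
  by (intro poly_eqI) (simp add: coeff_map_poly)

lemma map_poly_of_real_mult:
  "map_poly of_real (p * q) = (map_poly of_real p * map_poly of_real q :: 'a::real_normed_field poly)"
  by (intro poly_eqI) (simp add: coeff_map_poly coeff_mult)

lemma map_poly_of_real_power:
  "map_poly of_real (p ^ n) = (map_poly of_real p ^ n :: 'a::real_normed_field poly)"
  by (induction n) (auto simp: map_poly_of_real_mult)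

lemma map_poly_of_real_prod:
  "map_poly of_real (prod f S) = (\<Prod>s\<in>S. map_poly of_real (f s) :: 'a::real_normed_field poly)"
  by (induction S rule: infinite_finite_induct) (auto simp: map_poly_of_real_mult)

lemma map_poly_of_real_sum:
  "map_poly of_real (sum f S) = (\<Sum>s\<in>S. map_poly of_real (f s) :: 'a::real_normed_field poly)"
  by (induction S rule: infinite_finite_induct) (auto simp: map_poly_of_real_add)

lemma map_poly_of_real_pderiv:
  "map_poly of_real (pderiv p) = (pderiv (map_poly of_real p) :: 'a::real_normed_field poly)"
  by (intro poly_eqI) (simp add: coeff_map_poly coeff_pderiv)

lemma map_poly_of_real_linear:
  "map_poly of_real [:a, b:] = ([:of_real a, of_real b:] :: 'a::real_normed_field poly)"
  by (simp add: map_poly_pCons)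

lemma poly_map_poly_of_real:
  "poly (map_poly of_real p) (of_real x) = (of_real (poly p x) :: 'a::real_normed_field)"
  by (simp add: poly_altdef degree_map_poly coeff_map_poly)

text \<open>Evaluation facts are proved once over an arbitrary real normed field; this identity
  recovers their real instances in terms of plain \<open>poly\<close>.\<close>

lemma map_poly_of_real_real: "map_poly of_real p = (p :: real poly)"
  by (simp add: of_real_eq_id)

lemma map_poly_of_real_eq_iff:
  "map_poly of_real p = (map_poly of_real q :: 'a::real_normed_field poly) \<longleftrightarrow> p = q"
  by (metis coeff_map_poly of_real_0 of_real_eq_iff poly_eqI)

lemmas map_poly_of_real_simps =
  map_poly_of_real_add map_poly_of_real_diff map_poly_of_real_smult map_poly_of_real_mult
  map_poly_of_real_power map_poly_of_real_prod map_poly_of_real_sum map_poly_of_real_pderiv map_poly_of_real_linear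

text \<open>For finite \<open>R\<close> and nonzero \<open>k\<close>, writing a polynomial in this
  form says that all its complex zeros are real and simple, because \<open>R\<close> is a set and
  not a multiset.\<close>

definition split_poly :: "real \<Rightarrow> real set \<Rightarrow> real poly" where
  "split_poly k R = smult k (\<Prod>s\<in>R. [:- s, 1:])"

lemma poly_split_poly:
  "poly (map_poly of_real (split_poly k R)) z =
     (of_real k * (\<Prod>s\<in>R. z - of_real s) :: 'a::real_normed_field)"
  by (simp add: split_poly_def map_poly_of_real_simps poly_prod)

lemma split_poly_eq_0_iff:
  assumes "finite R" "k \<noteq> 0"
  shows "poly (map_poly of_real (split_poly k R)) z = (0 :: 'a::real_normed_field) \<longleftrightarrow> z \<in> of_real ` R"
  using assms by (auto simp: poly_split_poly)

lemma poly_split_poly_eq_0_iff: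
  assumes "finite R" "k \<noteq> 0"
  shows "poly (split_poly k R) x = 0 \<longleftrightarrow> x \<in> R"
  using split_poly_eq_0_iff[OF assms, of x] by (simp add: map_poly_of_real_real)

lemma degree_split_poly: "k \<noteq> 0 \<Longrightarrow> degree (split_poly k R) = card R"
  by (cases "finite R") (auto simp: split_poly_def degree_prod_eq_sum_degree)

lemma proots_split_poly:
  assumes "finite R" "k \<noteq> 0"
  shows "proots (split_poly k R) = mset_set R"
proof -
  have "proots (split_poly k R) = (\<Sum>s\<in>R. proots [:- s, 1:])"
    using assms by (simp add: split_poly_def proots_prod)
  also have "\<dots> = (\<Sum>s\<in>R. {#s#})" by simp
  also have "\<dots> = mset_set R" using assms(1) by (induction R) auto
  finally show ?thesis .
qed

text \<open>The logarithmic derivative of a product of linear factors, multiplied out.\<close>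

lemma poly_pderiv_split_poly:
  assumes "finite R" "z \<notin> of_real ` R"
  shows "poly (map_poly of_real (pderiv (split_poly k R))) z =
     (poly (map_poly of_real (split_poly k R)) z * (\<Sum>s\<in>R. 1 / (z - of_real s)) :: 'a::real_normed_field)"
proof -
  have "poly (map_poly of_real (pderiv (split_poly k R))) z =
      of_real k * (\<Sum>s\<in>R. (\<Prod>t\<in>R - {s}. z - of_real t))"
    by (simp add: split_poly_def pderiv_smult map_poly_of_real_simps pderiv_prod poly_sum poly_prod
        pderiv_pCons)
  also have "(\<Sum>s\<in>R. (\<Prod>t\<in>R - {s}. z - of_real t)) =
      (\<Sum>s\<in>R. (\<Prod>t\<in>R. z - of_real t) * (1 / (z - of_real s)))"
  proof (intro sum.cong refl)
    fix s assume s: "s \<in> R"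
    with assms have "z - of_real s \<noteq> 0" by auto
    then show "(\<Prod>t\<in>R - {s}. z - of_real t) = (\<Prod>t\<in>R. z - of_real t) * (1 / (z - of_real s))"
      using prod.remove[OF assms(1) s, of "\<lambda>t. z - of_real t"] by simp
  qed
  finally show ?thesis by (simp add: poly_split_poly sum_distrib_left)
qed

subsection \<open>Interlacing from separation\<close>

text \<open>Induction on the largest point: the gap below a new maximum holds a point of
  \<open>Q\<close> beyond all those counted before. Counting only points strictly inside the span of
  \<open>P\<close> lets the bound be applied to the part of \<open>P\<close> on one side of a
  threshold.\<close>

lemma card_separated:
  fixes P Q :: "real set"
  assumes "finite P" "finite Q"
    and "\<And>x y. x \<in> P \<Longrightarrow> y \<in> P \<Longrightarrow> x < y \<Longrightarrow> \<exists>q\<in>Q. x < q \<and> q < y"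
  shows "card P \<le> card {q\<in>Q. \<exists>x\<in>P. \<exists>y\<in>P. x < q \<and> q < y} + 1"
  using assms(1,3)
proof (induction P rule: finite_linorder_max_induct)
  case (insert b P)
  show ?case
  proof (cases "P = {}")
    case False
    define m where "m = Max P"
    have m: "m \<in> P" "\<And>x. x \<in> P \<Longrightarrow> x \<le> m" using False insert.hyps m_def by auto
    obtain q where q: "q \<in> Q" "m < q" "q < b" using insert.prems[of m b] insert.hyps m by auto
    let ?I = "\<lambda>P. {q\<in>Q. \<exists>x\<in>P. \<exists>y\<in>P. x < q \<and> q < y}"
    have "q \<notin> ?I P" using m q by force
    moreover have "insert q (?I P) \<subseteq> ?I (insert b P)" using q m by auto
    ultimately have "card (?I P) + 1 \<le> card (?I (insert b P))"
      using card_mono[of "?I (insert b P)" "insert q (?I P)"] assms(2) by auto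
    moreover have "card P \<le> card (?I P) + 1" using insert by blast
    moreover have "card (insert b P) = card P + 1" using insert.hyps by (subst card_insert_disjoint) auto
    ultimately show ?thesis by linarith
  qed auto
qed auto

text \<open>The first bound applies \<open>card_separated\<close> to the points of \<open>P\<close>
  above \<open>t\<close>. The second applies it to the points up to \<open>t\<close> and passes to
  complements by means of \<open>card P = card Q + 1\<close>.\<close>

lemma card_above_separated:
  fixes P Q :: "real set"
  assumes "finite P" "finite Q" "card P = card Q + 1"
    and sep: "\<And>x y. x \<in> P \<Longrightarrow> y \<in> P \<Longrightarrow> x < y \<Longrightarrow> \<exists>q\<in>Q. x < q \<and> q < y"
  shows "card {x\<in>P. t < x} \<le> card {x\<in>Q. t < x} + 1"
    and "card {x\<in>Q. t < x} \<le> card {x\<in>P. t < x}"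
proof -
  let ?I = "\<lambda>P. {q\<in>Q. \<exists>x\<in>P. \<exists>y\<in>P. x < q \<and> q < y}"
  have "card {x\<in>P. t < x} \<le> card (?I {x\<in>P. t < x}) + 1"
    using assms by (intro card_separated) auto
  also have "\<dots> \<le> card {x\<in>Q. t < x} + 1"
    using assms(2) by (auto intro!: card_mono)
  finally show "card {x\<in>P. t < x} \<le> card {x\<in>Q. t < x} + 1" .
  have "card {x\<in>P. x \<le> t} \<le> card (?I {x\<in>P. x \<le> t}) + 1"
    using assms by (intro card_separated) auto
  also have "\<dots> \<le> card {x\<in>Q. x \<le> t} + 1"
    using assms(2) by (auto intro!: card_mono)
  finally have "card {x\<in>P. x \<le> t} \<le> card {x\<in>Q. x \<le> t} + 1" .
  moreover have "card P = card {x\<in>P. t < x} + card {x\<in>P. x \<le> t}"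
    using assms(1) by (subst card_Un_disjoint[symmetric]) (auto intro: arg_cong[where f = card])
  moreover have "card Q = card {x\<in>Q. t < x} + card {x\<in>Q. x \<le> t}"
    using assms(2) by (subst card_Un_disjoint[symmetric]) (auto intro: arg_cong[where f = card])
  ultimately show "card {x\<in>Q. t < x} \<le> card {x\<in>P. t < x}" using assms(3) by linarith
qed

text \<open>The list decreases strictly, so a position equals the number of larger elements. This
  turns inequalities between listed zeros into counts.\<close>

lemma card_above_nth:
  fixes P :: "real set"
  assumes "finite P" "i < card P"
  defines "xs \<equiv> rev (sorted_list_of_set P)"
  shows "card {x\<in>P. xs ! i < x} = i" and "card {x\<in>P. xs ! i \<le> x} = i + 1"
proof -
  have len: "length xs = card P" by (simp add: xs_def)
  have st: "sorted_wrt (>) xs"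
    by (simp add: xs_def sorted_wrt_rev)
  have set: "P = set xs" using assms(1) by (simp add: xs_def)
  have dist: "distinct xs" by (simp add: xs_def)
  have less: "xs ! i < xs ! j \<longleftrightarrow> j < i" if "j < card P" for j
    using that assms(2) sorted_wrt_nth_less[OF st, of i j] sorted_wrt_nth_less[OF st, of j i] len
    by (cases i j rule: linorder_cases) auto
  have le: "xs ! i \<le> xs ! j \<longleftrightarrow> j \<le> i" if "j < card P" for j
    using that assms(2) sorted_wrt_nth_less[OF st, of i j] sorted_wrt_nth_less[OF st, of j i] len
    by (cases i j rule: linorder_cases) auto
  have inj: "inj_on ((!) xs) {..<card P}" using dist len by (simp add: inj_on_nth)
  have P: "P = (!) xs ` {..<card P}" using set len by (auto simp: set_conv_nth)
  have "{x\<in>P. xs ! i < x} = (!) xs ` {..<i}"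
    using less assms(2) by (subst (1) P) auto
  then show "card {x\<in>P. xs ! i < x} = i"
    using card_image[OF inj_on_subset[OF inj]] assms(2) by fastforce
  have "{x\<in>P. xs ! i \<le> x} = (!) xs ` {..i}"
    using le assms(2) by (subst (1) P) auto
  then show "card {x\<in>P. xs ! i \<le> x} = i + 1"
    using card_image[OF inj_on_subset[OF inj], of "{..i}"] assms(2) by (auto simp: subset_iff)
qed

text \<open>If an inequality failed at position \<open>i\<close>, its smaller entry as threshold
  \<open>t\<close> would violate one of the two counting bounds.\<close>

lemma sorted_interlace:
  fixes P Q :: "real set"
  assumes "finite P" "finite Q" "card P = card Q + 1" "i < card Q"
    and "\<And>t. card {x\<in>P. t < x} \<le> card {x\<in>Q. t < x} + 1"
    and "\<And>t. card {x\<in>Q. t < x} \<le> card {x\<in>P. t < x}"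
  shows "rev (sorted_list_of_set P) ! (i + 1) \<le> rev (sorted_list_of_set Q) ! i"
    and "rev (sorted_list_of_set Q) ! i \<le> rev (sorted_list_of_set P) ! i"
proof -
  let ?p = "\<lambda>i. rev (sorted_list_of_set P) ! i" and ?q = "\<lambda>i. rev (sorted_list_of_set Q) ! i"
  show "?p (i + 1) \<le> ?q i"
  proof (rule ccontr)
    assume "\<not> ?thesis"
    then have "card {x\<in>P. ?p (i + 1) \<le> x} \<le> card {x\<in>P. ?q i < x}"
      using assms(1) by (intro card_mono) auto
    then show False
      using card_above_nth(2)[of P "i + 1"] card_above_nth(1)[of Q i] assms(1-4) assms(5)[of "?q i"]
      by auto
  qed
  show "?q i \<le> ?p i"
  proof (rule ccontr)
    assume "\<not> ?thesis"
    then have "card {x\<in>Q. ?q i \<le> x} \<le> card {x\<in>Q. ?p i < x}"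
      using assms(2) by (intro card_mono) auto
    then show False
      using card_above_nth(2)[of Q i] card_above_nth(1)[of P i] assms(1-4) assms(6)[of "?p i"]
      by auto
  qed
qed

subsection \<open>The differential recurrence\<close>

lemma T_eq_0: "k < 0 \<or> int n < k \<Longrightarrow> T lam a1 a2 b1 b2 n k = 0"
  by (cases n) auto

lemma coeff_T_poly: "coeff (T_poly lam a1 a2 b1 b2 n) k = T lam a1 a2 b1 b2 n (int k)"
  by (simp add: T_poly_def coeff_sum T_eq_0 sum.delta)

lemma T_poly_0 [simp]: "T_poly lam a1 a2 b1 b2 0 = 1"
  by (intro poly_eqI) (simp add: coeff_T_poly)

definition quad_coef :: "real \<Rightarrow> real \<Rightarrow> real \<Rightarrow> real poly" where
  "quad_coef lam a1 b1 = [:lam, 1:] * [:b1 * lam + a1, b1:]"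

definition lin_coef :: "real \<Rightarrow> real \<Rightarrow> real \<Rightarrow> real \<Rightarrow> real poly" where
  "lin_coef lam a2 b1 b2 = [:(b1 + b2) * lam + a2, b1 + b2:]"

text \<open>The upper bound on \<open>k\<close> in the guard can go, since beyond
  \<open>n + 1\<close> all three terms vanish.\<close>

lemma T_Suc:
  "T lam a1 a2 b1 b2 (Suc n) k =
     (if k < 0 then 0 else
        (b1 * of_int k + b2) * T lam a1 a2 b1 b2 n (k - 1)
        + ((2 * lam * b1 + a1) * of_int k + a2 + lam * (b1 + b2)) * T lam a1 a2 b1 b2 n k
        + lam * (a1 + lam * b1) * (of_int k + 1) * T lam a1 a2 b1 b2 n (k + 1))"
  by (auto simp: T_eq_0)

lemma T_poly_Suc:
  "T_poly lam a1 a2 b1 b2 (Suc n) =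
     quad_coef lam a1 b1 * pderiv (T_poly lam a1 a2 b1 b2 n)
     + lin_coef lam a2 b1 b2 * T_poly lam a1 a2 b1 b2 n"
proof (intro poly_eqI)
  fix k
  have A: "quad_coef lam a1 b1 = [:lam * (b1 * lam + a1), 2 * b1 * lam + a1, b1:]"
    by (simp add: quad_coef_def algebra_simps)
  \<comment> \<open>\<open>quad_coef\<close> has degree at most 2, so its product with the
    derivative reaches back to index \<open>k - 2\<close>; the two smallest indices have fewer
    terms.\<close>
  consider "k = 0" | "k = Suc 0" | m where "k = Suc (Suc m)" by (metis not0_implies_Suc)
  then show "coeff (T_poly lam a1 a2 b1 b2 (Suc n)) k =
    coeff (quad_coef lam a1 b1 * pderiv (T_poly lam a1 a2 b1 b2 n)
     + lin_coef lam a2 b1 b2 * T_poly lam a1 a2 b1 b2 n) k"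
  proof cases
    case 1
    then show ?thesis unfolding coeff_T_poly T_Suc A lin_coef_def
      by (simp add: coeff_pderiv coeff_T_poly T_eq_0 algebra_simps)
  next
    case 2
    then show ?thesis unfolding coeff_T_poly T_Suc A lin_coef_def
      by (simp add: coeff_pderiv coeff_T_poly algebra_simps)
  next
    case 3
    then show ?thesis unfolding coeff_T_poly T_Suc A lin_coef_def
      by (simp add: coeff_pderiv coeff_T_poly algebra_simps)
  qed
qed

lemma poly_quad_coef:
  "poly (map_poly of_real (quad_coef lam a1 b1)) z =
     ((z + of_real lam) * (of_real b1 * (z + of_real lam) + of_real a1) :: 'a::real_normed_field)"
  unfolding quad_coef_def map_poly_of_real_mult by (simp add: map_poly_of_real_linear algebra_simps)

lemma poly_quad_coef_real:
  "poly (quad_coef lam a1 b1) x = (x + lam) * (b1 * (x + lam) + a1)"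
  by (simp add: quad_coef_def algebra_simps)

lemma poly_lin_coef:
  "poly (map_poly of_real (lin_coef lam a2 b1 b2)) z =
     (of_real (b1 + b2) * (z + of_real lam) + of_real a2 :: 'a::real_normed_field)"
  by (simp add: lin_coef_def map_poly_of_real_linear algebra_simps)

text \<open>The partial fraction form of T(n+1)/T(n) when T(n) has zero set \<open>R\<close>. The
  first two terms are B(z); each summand is A(z)/(z - s), where division of A by z - s leaves the
  remainder A(s).\<close>

definition quot_fun :: "real \<Rightarrow> real \<Rightarrow> real \<Rightarrow> real \<Rightarrow> real \<Rightarrow> real set \<Rightarrow> 'a \<Rightarrow> 'a::real_normed_field" where
  "quot_fun lam a1 a2 b1 b2 R z =
     of_real (b1 + b2) * (z + of_real lam) + of_real a2
     + (\<Sum>s\<in>R. of_real b1 * (z + of_real lam) + of_real (b1 * (s + lam) + a1)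
           + of_real (poly (quad_coef lam a1 b1) s) / (z - of_real s))"

lemma poly_step_split_poly:
  assumes "finite R" "z \<notin> of_real ` R"
  shows "poly (map_poly of_real (quad_coef lam a1 b1 * pderiv (split_poly k R)
        + lin_coef lam a2 b1 b2 * split_poly k R)) z =
     (poly (map_poly of_real (split_poly k R)) z * quot_fun lam a1 a2 b1 b2 R z :: 'a::real_normed_field)"
proof -
  let ?A = "poly (map_poly of_real (quad_coef lam a1 b1)) z :: 'a"
  have "?A * (1 / (z - of_real s)) =
     of_real b1 * (z + of_real lam) + of_real (b1 * (s + lam) + a1)
           + of_real (poly (quad_coef lam a1 b1) s) / (z - of_real s)" if "s \<in> R" for s
  proof -
    have "z - of_real s \<noteq> 0" using that assms(2) by auto
    then show ?thesis
      by (simp add: poly_quad_coef poly_quad_coef_real divide_simps) (simp add: algebra_simps)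
  qed
  then have "?A * (\<Sum>s\<in>R. 1 / (z - of_real s)) + poly (map_poly of_real (lin_coef lam a2 b1 b2)) z
     = quot_fun lam a1 a2 b1 b2 R z"
    by (simp add: quot_fun_def sum_distrib_left poly_lin_coef
        cong: sum.cong)
  then show ?thesis
    by (simp add: map_poly_of_real_add map_poly_of_real_mult poly_pderiv_split_poly[OF assms]
        algebra_simps flip: distrib_left)
qed

text \<open>Only zeros with nonzero residue A(s) are excluded. If A(s) = 0, the fraction is
  constantly 0, at z = s by the convention x / 0 = 0, so there is no pole.\<close>

lemma quot_fun_has_derivative:
  fixes b1 :: real
  assumes "finite R" "z \<notin> of_real ` {s\<in>R. poly (quad_coef lam a1 b1) s \<noteq> 0}"
  shows "(quot_fun lam a1 a2 b1 b2 R has_field_derivative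
     (of_real (b1 + b2 + card R * b1)
       - (\<Sum>s\<in>R. of_real (poly (quad_coef lam a1 b1) s) / (z - of_real s)\<^sup>2))) (at (z :: 'a::real_normed_field))"
proof -
  let ?a = "\<lambda>s. poly (quad_coef lam a1 b1) s"
  have D: "((\<lambda>z. of_real b1 * (z + of_real lam) + of_real (b1 * (s + lam) + a1)
           + of_real (?a s) / (z - of_real s)) has_field_derivative
        (of_real b1 - of_real (?a s) / (z - of_real s)\<^sup>2)) (at z)" if "s \<in> R" for s
  proof (cases "?a s = 0")
    case True
    then show ?thesis by (auto intro!: derivative_eq_intros)
  next
    case False
    then have "z - of_real s \<noteq> 0" using that assms(2) by auto
    then show ?thesis by (auto intro!: derivative_eq_intros simp: power2_eq_square)
  qed
  have "(quot_fun lam a1 a2 b1 b2 R has_field_derivative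
     (of_real (b1 + b2) + (\<Sum>s\<in>R. of_real b1 - of_real (?a s) / (z - of_real s)\<^sup>2))) (at z)"
    unfolding quot_fun_def[abs_def]
    by (intro DERIV_add DERIV_sum D) (auto intro!: derivative_eq_intros)
  then show ?thesis by (simp add: sum_subtractf algebra_simps)
qed

lemma T_diag_Suc:
  "T lam a1 a2 b1 b2 (Suc n) (int (Suc n)) = (b1 * real (Suc n) + b2) * T lam a1 a2 b1 b2 n (int n)"
  unfolding T_Suc by (simp add: T_eq_0)

lemma T_diag_pos:
  assumes "0 \<le> b1" "0 \<le> b2" "0 < b1 + b2"
  shows "0 < T lam a1 a2 b1 b2 n (int n)"
proof (induction n)
  case (Suc n)
  have "0 < b1 * real (Suc n) + b2" using assms by (cases "b1 = 0") (auto intro: add_pos_nonneg)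
  then show ?case using Suc by (simp only: T_diag_Suc mult_pos_pos)
qed simp

lemma degree_T_poly:
  assumes "0 \<le> b1" "0 \<le> b2" "0 < b1 + b2"
  shows "degree (T_poly lam a1 a2 b1 b2 n) = n"
  using T_diag_pos[OF assms, of lam a1 a2 n]
  by (intro antisym degree_le le_degree) (auto simp: coeff_T_poly T_eq_0)

text \<open>At a zero of A the derivative term drops out and the recurrence becomes T(n+1) = B T(n).
  This decides which end points of the interval can be zeros.\<close>

lemma poly_T_poly_at_quad_root:
  "poly (quad_coef lam a1 b1) x = 0 \<Longrightarrow>
    poly (T_poly lam a1 a2 b1 b2 n) x = poly (lin_coef lam a2 b1 b2) x ^ n"
  by (induction n) (auto simp: T_poly_Suc)

subsection \<open>Zeros\<close>

text \<open>The nondegenerate case: \<open>0 < b1 + b2\<close> makes the degree exactly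
  \<open>n\<close>, and \<open>0 < a1\<close> makes the derivative of A nonzero at the zeros of A,
  on which simplicity rests.\<close>

locale tri_params =
  fixes lam a1 a2 b1 b2 :: real
  assumes a1: "0 < a1" and a2: "0 \<le> a2" and b1: "0 \<le> b1" and b2: "0 \<le> b2"
    and b_pos: "0 < b1 + b2" and cond: "b1 * a2 \<le> a1 * (b1 + b2)"
begin

abbreviation "S \<equiv> T_poly lam a1 a2 b1 b2"
abbreviation "A \<equiv> quad_coef lam a1 b1"
abbreviation "B \<equiv> lin_coef lam a2 b1 b2"
abbreviation "psi \<equiv> quot_fun lam a1 a2 b1 b2"
abbreviation "lc n \<equiv> T lam a1 a2 b1 b2 n (int n)"

text \<open>The interval is closed because an end point can be a zero. Its left bound is cleared of
  the denominator, which treats \<open>b1 = 0\<close> uniformly.\<close>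

definition in_range :: "real \<Rightarrow> bool" where
  "in_range s \<longleftrightarrow> s + lam \<le> 0 \<and> 0 \<le> b1 * (s + lam) + a1"

definition Z :: "nat \<Rightarrow> real set" where
  "Z n = {x. poly (S n) x = 0}"

lemma lc_pos: "0 < lc n"
  using T_diag_pos b1 b2 b_pos by auto

lemma degree_S: "degree (S n) = n"
  using degree_T_poly b1 b2 b_pos by auto

lemma S_nonzero: "S n \<noteq> 0"
  using lc_pos[of n] coeff_T_poly[of lam a1 a2 b1 b2 n n] by auto

lemma finite_Z: "finite (Z n)"
  unfolding Z_def using S_nonzero by (rule poly_roots_finite)

lemma in_range_A: "in_range s \<Longrightarrow> poly A s \<le> 0"
  by (auto simp: in_range_def poly_quad_coef_real intro: mult_nonpos_nonneg)

lemma slope_pos: "0 < b1 + b2 + real m * b1"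
  using b1 by (intro add_pos_nonneg[OF b_pos]) auto

text \<open>Every term carries the factor Im z, since Im (1/(z - s)) = - Im z / |z - s|^2. When all
  A(s) are nonpositive, the other factor is positive.\<close>

lemma Im_psi:
  assumes "finite R"
  shows "Im (psi R z) = Im z * (b1 + b2 + real (card R) * b1
    - (\<Sum>s\<in>R. poly A s / (cmod (z - of_real s))\<^sup>2))"
proof -
  have "Im (of_real (poly A s) / (z - of_real s)) = - Im z * (poly A s / (cmod (z - of_real s))\<^sup>2)" for s
    by (simp add: Im_divide cmod_power2)
  then have "Im (psi R z) = (b1 + b2) * Im z
     + (\<Sum>s\<in>R. b1 * Im z - Im z * (poly A s / (cmod (z - of_real s))\<^sup>2))"
    unfolding quot_fun_def by simp
  also have "\<dots> = (b1 + b2) * Im z + (real (card R) * (b1 * Im z)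
     - Im z * (\<Sum>s\<in>R. poly A s / (cmod (z - of_real s))\<^sup>2))"
    by (simp add: sum_subtractf sum_distrib_left)
  finally show ?thesis by (simp add: algebra_simps)
qed

lemma psi_deriv_pos:
  fixes x :: real
  assumes "\<And>s. s \<in> R \<Longrightarrow> in_range s"
  shows "0 < b1 + b2 + real (card R) * b1 - (\<Sum>s\<in>R. poly A s / (x - s)\<^sup>2)"
proof -
  have "(\<Sum>s\<in>R. poly A s / (x - s)\<^sup>2) \<le> 0"
    using assms in_range_A by (intro sum_nonpos divide_nonpos_nonneg) auto
  then show ?thesis using slope_pos[of "card R"] by linarith
qed

text \<open>The induction invariant: simple real zeros give the partial fractions, and their place
  in the interval gives the sign of the residues.\<close>

definition splits :: "nat \<Rightarrow> bool" where
  "splits n \<longleftrightarrow> S n = split_poly (lc n) (Z n) \<and> (\<forall>s\<in>Z n. in_range s)"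

lemma splits_S: "splits n \<Longrightarrow> S n = split_poly (lc n) (Z n)"
  and splits_in_range: "splits n \<Longrightarrow> s \<in> Z n \<Longrightarrow> in_range s"
  by (auto simp: splits_def)

lemma card_Z: "splits n \<Longrightarrow> card (Z n) = n"
  using degree_S[of n] degree_split_poly[of "lc n" "Z n"] splits_S[of n] lc_pos[of n] by simp

lemma S_complex_zero_iff:
  assumes "splits n"
  shows "poly (map_poly of_real (S n)) z = (0 :: 'a::real_normed_field) \<longleftrightarrow> z \<in> of_real ` Z n"
  using splits_S[OF assms] split_poly_eq_0_iff[OF finite_Z, of "lc n" n z] lc_pos[of n] by simp

lemma S_Suc_eq_psi:
  assumes "splits n" "z \<notin> of_real ` Z n"
  shows "poly (map_poly of_real (S (Suc n))) z =
    (poly (map_poly of_real (S n)) z * psi (Z n) z :: 'a::real_normed_field)"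
  using poly_step_split_poly[OF finite_Z assms(2), of lam a1 b1 "lc n" a2 b2]
  by (simp add: T_poly_Suc flip: splits_S[OF assms(1)])

lemma S_Suc_eq_psi_real:
  assumes "splits n" "x \<notin> Z n"
  shows "poly (S (Suc n)) x = poly (S n) x * psi (Z n) x"
  using S_Suc_eq_psi[OF assms(1), of x] assms(2) by (simp add: map_poly_of_real_real)

text \<open>With g = \<open>S n\<close> and f = \<open>S (Suc n)\<close> = g psi, f' g - f g' equals
  g^2 psi'. The factorization holds only off \<open>Z n\<close>, whose complement is open, so the
  derivative carries over there.\<close>

lemma wronskian:
  fixes z :: "'a::real_normed_field"
  assumes "splits n" "z \<notin> of_real ` Z n"
  shows "poly (map_poly of_real (pderiv (S (Suc n)) * S n - S (Suc n) * pderiv (S n))) z =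
     (poly (map_poly of_real (S n)) z)\<^sup>2 * (of_real (b1 + b2 + real n * b1)
       - (\<Sum>s\<in>Z n. of_real (poly A s) / (z - of_real s)\<^sup>2))"
proof -
  let ?f = "map_poly of_real (S (Suc n)) :: 'a poly" and ?g = "map_poly of_real (S n) :: 'a poly"
  define D where
    "D = of_real (b1 + b2 + real n * b1) - (\<Sum>s\<in>Z n. of_real (poly A s) / (z - of_real s)\<^sup>2)"
  have "(psi (Z n) has_field_derivative D) (at z)"
    using quot_fun_has_derivative[OF finite_Z, of z n lam a1 b1 a2 b2] assms
    by (auto simp: card_Z D_def)
  then have "((\<lambda>w. poly ?g w * psi (Z n) w) has_field_derivative
      (poly (pderiv ?g) z * psi (Z n) z + D * poly ?g z)) (at z)"
    by (intro DERIV_mult poly_DERIV)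
  moreover have "open (- (of_real ` Z n :: 'a set))"
    using finite_Z by (intro open_Compl finite_imp_closed) auto
  moreover have "z \<in> - (of_real ` Z n)" using assms(2) by simp
  ultimately have "(poly ?f has_field_derivative
      (poly (pderiv ?g) z * psi (Z n) z + D * poly ?g z)) (at z)"
    by (rule has_field_derivative_transform_within_open) (simp add: S_Suc_eq_psi[OF assms(1)])
  then have "poly (pderiv ?f) z = poly (pderiv ?g) z * psi (Z n) z + D * poly ?g z"
    using poly_DERIV DERIV_unique by blast
  moreover have "poly ?f z = poly ?g z * psi (Z n) z"
    using S_Suc_eq_psi[OF assms] .
  ultimately show ?thesis
    unfolding D_def[symmetric]
    by (simp add: map_poly_of_real_simps power2_eq_square algebra_simps)
qed

text \<open>Outside the interval all differences x - s have one sign, so A(x) times the sum of their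
  reciprocals cannot cancel B(x): to the right both are nonnegative, to the left both nonpositive,
  and B(x) is nonzero either way.\<close>

lemma Z_Suc_in_range:
  assumes "splits n" "x \<in> Z (Suc n)"
  shows "in_range x"
proof (rule ccontr)
  assume out: "\<not> in_range x"
  then have x: "x \<notin> Z n" using splits_in_range assms(1) by blast
  let ?S = "\<Sum>s\<in>Z n. 1 / (x - s)"
  have g: "poly (S n) x \<noteq> 0" using x by (simp add: Z_def)
  have "poly (pderiv (S n)) x = poly (S n) x * ?S"
    using poly_pderiv_split_poly[OF finite_Z, of x n "lc n"] x
    by (simp add: map_poly_of_real_real flip: splits_S[OF assms(1)])
  then have "poly (S (Suc n)) x = poly (S n) x * (poly A x * ?S + poly B x)"
    by (simp add: T_poly_Suc algebra_simps)
  then have zero: "poly A x * ?S + poly B x = 0" using assms(2) g by (simp add: Z_def)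
  have B: "poly B x = (b1 + b2) * (x + lam) + a2"
    by (simp add: lin_coef_def algebra_simps)
  show False
  proof (cases "x + lam \<le> 0")
    case False
    have "0 \<le> ?S"
      using splits_in_range[OF assms(1)] False
      by (intro sum_nonneg) (force simp: in_range_def)
    moreover have "0 \<le> poly A x" using False b1 a1 by (simp add: poly_quad_coef_real)
    moreover have "0 < poly B x" using False b_pos a2 by (simp add: B add_pos_nonneg)
    ultimately show False using zero by (metis add_nonneg_pos mult_nonneg_nonneg less_irrefl)
  next
    case True
    with out have neg: "b1 * (x + lam) + a1 < 0" by (auto simp: in_range_def)
    with a1 b1 have b1': "0 < b1" by (cases "b1 = 0") auto
    have "?S \<le> 0"
    proof (rule sum_nonpos)
      fix s assume "s \<in> Z n"
      then have "b1 * (x + lam) < b1 * (s + lam)"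
        using splits_in_range[OF assms(1)] neg by (force simp: in_range_def)
      then show "1 / (x - s) \<le> 0" using b1' by simp
    qed
    moreover have "0 \<le> poly A x" using True neg by (simp add: poly_quad_coef_real mult_nonpos_nonpos)
    moreover have "poly B x < 0"
    proof -
      \<comment> \<open>Here \<open>cond\<close> enters, replacing b1 a2 by the upper bound a1 (b1 +
        b2).\<close>
      have "b1 * poly B x \<le> (b1 + b2) * (b1 * (x + lam) + a1)"
        using cond by (simp add: B algebra_simps)
      also have "\<dots> < 0" using b_pos neg by (rule mult_pos_neg)
      finally show ?thesis using b1' by (simp add: mult_less_0_iff)
    qed
    ultimately show False using zero
      by (metis add_nonpos_neg mult_nonneg_nonpos less_irrefl)
  qed
qed

lemma B_at_left_end:
  assumes "b1 * (x + lam) + a1 = 0"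
  shows "poly B x \<le> 0"
proof -
  have "b1 * poly B x = (b1 + b2) * (b1 * (x + lam) + a1) - (a1 * (b1 + b2) - b1 * a2)"
    by (simp add: lin_coef_def algebra_simps)
  then have "b1 * poly B x \<le> 0" using assms cond by simp
  moreover have "0 < b1" using assms a1 b1 by (cases "b1 = 0") auto
  ultimately show ?thesis by (simp add: mult_le_0_iff)
qed

lemma pderiv_S_nonzero:
  assumes "splits n" "x \<in> Z n"
  shows "poly (pderiv (S n)) x \<noteq> 0"
proof -
  have "split_poly (lc n) (Z n) = [:- x, 1:] * split_poly (lc n) (Z n - {x})"
    unfolding split_poly_def using assms(2) finite_Z by (simp add: prod.remove)
  then have "poly (pderiv (S n)) x = poly (split_poly (lc n) (Z n - {x})) x"
    unfolding splits_S[OF assms(1)] by (simp only: pderiv_mult) (simp add: pderiv_pCons)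
  then show ?thesis
    using poly_split_poly_eq_0_iff[of "Z n - {x}" "lc n" x] finite_Z lc_pos[of n] by simp
qed

text \<open>Off \<open>Z n\<close>, the Wronskian at x is the derivative times \<open>S n\<close>,
  and it is positive because psi increases. At a common zero the recurrence forces A(x) = 0, and the
  derivative becomes (A' + B) times that of \<open>S n\<close>; there A' is a1 with B nonnegative at
  the right end, and - a1 with B nonpositive at the left end.\<close>

lemma pderiv_S_Suc_nonzero:
  assumes "splits n" "x \<in> Z (Suc n)"
  shows "poly (pderiv (S (Suc n))) x \<noteq> 0"
proof (cases "x \<in> Z n")
  case False
  have "poly (pderiv (S (Suc n))) x * poly (S n) x =
     (poly (S n) x)\<^sup>2 * (b1 + b2 + real n * b1 - (\<Sum>s\<in>Z n. poly A s / (x - s)\<^sup>2))"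
    using wronskian[OF assms(1), of x] assms(2) False by (simp add: map_poly_of_real_real Z_def)
  moreover have "0 < b1 + b2 + real n * b1 - (\<Sum>s\<in>Z n. poly A s / (x - s)\<^sup>2)"
    using psi_deriv_pos[of "Z n" x] splits_in_range[OF assms(1)] by (simp add: card_Z[OF assms(1)])
  moreover have "poly (S n) x \<noteq> 0" using False by (simp add: Z_def)
  ultimately show ?thesis by auto
next
  case True
  then have d: "poly (pderiv (S n)) x \<noteq> 0" using assms(1) by (rule pderiv_S_nonzero[rotated])
  have "poly A x = 0" using assms(2) True d by (simp add: Z_def T_poly_Suc)
  moreover have "poly (pderiv (S (Suc n))) x =
      (poly (pderiv A) x + poly B x) * poly (pderiv (S n)) x"
    using \<open>poly A x = 0\<close> True by (simp add: Z_def T_poly_Suc pderiv_mult pderiv_add algebra_simps)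
  moreover have "poly (pderiv A) x + poly B x \<noteq> 0"
  proof -
    have A': "poly (pderiv A) x = b1 * (x + lam) + (b1 * (x + lam) + a1)"
      unfolding quad_coef_def pderiv_mult by (simp add: pderiv_pCons algebra_simps)
    from \<open>poly A x = 0\<close> consider "x + lam = 0" | "b1 * (x + lam) + a1 = 0"
      by (auto simp: poly_quad_coef_real)
    then show ?thesis
    proof cases
      case 1
      then have "x = - lam" by simp
      then show ?thesis using a1 a2 unfolding A' lin_coef_def by simp
    next
      case 2
      then show ?thesis using B_at_left_end[OF 2] a1 unfolding A' by linarith
    qed
  qed
  ultimately show ?thesis using d by simp
qed

lemma S_Suc_real_zeros:
  assumes "splits n" "poly (map_poly of_real (S (Suc n))) z = (0 :: complex)"
  shows "z \<in> of_real ` Z (Suc n)"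
proof -
  have "Im z = 0"
  proof (rule ccontr)
    assume "Im z \<noteq> 0"
    then have z: "z \<notin> of_real ` Z n" by auto
    then have "psi (Z n) z = 0"
      using S_Suc_eq_psi[OF assms(1) z] S_complex_zero_iff[OF assms(1), of z] assms(2) by simp
    moreover have "0 < b1 + b2 + real (card (Z n)) * b1 - (\<Sum>s\<in>Z n. poly A s / (cmod (z - of_real s))\<^sup>2)"
    proof -
      have "(\<Sum>s\<in>Z n. poly A s / (cmod (z - of_real s))\<^sup>2) \<le> 0"
        using splits_in_range[OF assms(1)] in_range_A by (intro sum_nonpos divide_nonpos_nonneg) auto
      then show ?thesis using slope_pos[of "card (Z n)"] by linarith
    qed
    ultimately show False using Im_psi[OF finite_Z, of n z] \<open>Im z \<noteq> 0\<close> by simp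
  qed
  then have "z = of_real (Re z)" by (simp add: complex_eq_iff)
  moreover from this have "Re z \<in> Z (Suc n)"
    using assms(2) poly_map_poly_of_real[of "S (Suc n)" "Re z", where 'a = complex]
    by (simp add: Z_def)
  ultimately show ?thesis by blast
qed

text \<open>All complex zeros are real and none is double, so the polynomial is a product of
  distinct linear factors over the complex numbers. The factorization descends to the reals by
  injectivity of the coefficient embedding.\<close>

lemma splits_Suc:
  assumes "splits n"
  shows "splits (Suc n)"
proof -
  let ?p = "map_poly of_real (S (Suc n)) :: complex poly"
  have zeros: "{z. poly ?p z = 0} = of_real ` Z (Suc n)"
    using S_Suc_real_zeros[OF assms] by (auto simp: poly_map_poly_of_real Z_def)
  have "rsquarefree ?p"
    unfolding rsquarefree_roots
  proof (intro allI notI, elim conjE)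
    fix z assume "poly ?p z = 0" and d: "poly (pderiv ?p) z = 0"
    then obtain x where x: "z = of_real x" "x \<in> Z (Suc n)" using zeros by blast
    then show False
      using d pderiv_S_Suc_nonzero[OF assms x(2)]
      by (simp add: poly_map_poly_of_real flip: map_poly_of_real_pderiv)
  qed
  then have "?p = smult (lead_coeff ?p) (\<Prod>z\<in>of_real ` Z (Suc n). [:- z, 1:])"
    using complex_poly_decompose_rsquarefree[of ?p] zeros by simp
  also have "lead_coeff ?p = of_real (lc (Suc n))"
    using degree_S[of "Suc n"]
    by (simp add: degree_map_poly coeff_map_poly coeff_T_poly del: T.simps)
  also have "(\<Prod>z\<in>of_real ` Z (Suc n). [:- z, 1:]) = (\<Prod>s\<in>Z (Suc n). [:- complex_of_real s, 1:])"
    by (subst prod.reindex) (auto simp: inj_on_def)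
  also have "smult (of_real (lc (Suc n))) \<dots> = map_poly of_real (split_poly (lc (Suc n)) (Z (Suc n)))"
    by (simp add: split_poly_def map_poly_of_real_simps del: T.simps)
  finally have "S (Suc n) = split_poly (lc (Suc n)) (Z (Suc n))"
    by (simp only: map_poly_of_real_eq_iff)
  then show ?thesis using Z_Suc_in_range[OF assms] by (auto simp: splits_def)
qed

lemma splits: "splits n"
proof (induction n)
  case 0
  show ?case by (simp add: splits_def Z_def split_poly_def)
qed (rule splits_Suc)

end

section \<open>Interlacing, the Turan polynomial and the end points\<close>

lemma zeros_desc_split_poly:
  "finite R \<Longrightarrow> k \<noteq> 0 \<Longrightarrow> zeros_desc (split_poly k R) = rev (sorted_list_of_set R)"
  by (simp add: zeros_desc_def proots_split_poly)

lemma card_filter_Diff_Int: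
  assumes "finite X"
  shows "card {x\<in>X. P x} = card {x\<in>X - Y. P x} + card {x\<in>Y \<inter> X. P x}"
  using assms by (subst card_Un_disjoint[symmetric]) (auto intro: arg_cong[where f = card])

text \<open>For Re w > 0 the sign of the imaginary part depends only on \<open>c\<close> and Im
  w.\<close>

lemma Im_of_real_divide_power2:
  "Im (of_real c / w\<^sup>2) = - 2 * Im w * (c * (Re w / cmod w ^ 4))"
proof -
  have "cmod w ^ 4 = (Re (w\<^sup>2))\<^sup>2 + (Im (w\<^sup>2))\<^sup>2"
    unfolding cmod_power2[symmetric] by (simp add: norm_power flip: power_mult)
  then show ?thesis by (simp add: Im_divide Im_power2)
qed

context tri_params
begin

text \<open>psi vanishes at both x and y. If every zero of \<open>S n\<close> in between were
  shared, psi would have no pole there and would increase strictly from x to y.\<close>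

lemma separated:
  assumes "x \<in> Z (Suc n) - Z n" "y \<in> Z (Suc n) - Z n" "x < y"
  shows "\<exists>q\<in>Z n - Z (Suc n). x < q \<and> q < y"
proof (rule ccontr)
  assume none: "\<not> ?thesis"
  have A0: "poly A s = 0" if "s \<in> Z n" "x < s" "s < y" for s
  proof -
    \<comment> \<open>At a shared zero the recurrence leaves A(s) times the nonzero derivative of
      \<open>S n\<close> equal to 0.\<close>
    have "s \<in> Z (Suc n)" using that none by blast
    then show ?thesis
      using that(1) pderiv_S_nonzero[OF splits that(1)] by (simp add: Z_def T_poly_Suc)
  qed
  have "psi (Z n) x < psi (Z n) y"
  proof (rule DERIV_pos_imp_increasing[OF assms(3)])
    fix w assume w: "x \<le> w" "w \<le> y"
    have "w \<notin> of_real ` {s \<in> Z n. poly A s \<noteq> 0}"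
      using w A0[of w] assms(1,2) by (cases "w = x"; cases "w = y") auto
    from quot_fun_has_derivative[OF finite_Z this, of a2 b2]
      psi_deriv_pos[of "Z n" w] splits_in_range[OF splits]
    show "\<exists>d. (psi (Z n) has_real_derivative d) (at w) \<and> 0 < d"
      by fastforce
  qed
  moreover have "psi (Z n) v = 0" if "v \<in> Z (Suc n) - Z n" for v
    using S_Suc_eq_psi_real[OF splits, of v n] that by (auto simp: Z_def)
  ultimately show False using assms(1,2) by simp
qed

lemma S_real_rooted: "real_rooted (S n)"
  using S_complex_zero_iff[OF splits, of n, where 'a = complex] by (auto simp: real_rooted_def)

lemma S_simple_zeros: "simple_zeros (S n)"
  unfolding simple_zeros_def
proof (intro allI impI)
  fix z :: complex assume z: "poly (map_poly of_real (S n)) z = 0"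
  then obtain x where x: "z = of_real x" "x \<in> Z n"
    using S_complex_zero_iff[OF splits, of n z] by auto
  have "poly (pderiv (map_poly of_real (S n))) z \<noteq> 0"
    using pderiv_S_nonzero[OF splits x(2)] by (simp add: x poly_map_poly_of_real flip: map_poly_of_real_pderiv)
  moreover from this have "map_poly of_real (S n) \<noteq> (0 :: complex poly)" by auto
  ultimately show "order z (map_poly of_real (S n)) = 1"
    using z order_pderiv[of "map_poly of_real (S n)" z] order_root
    by (metis One_nat_def order_0I pderiv_0 poly_0)
qed

text \<open>Separation is available only for zeros that are not shared, so counting is done on
  \<open>?P\<close> and \<open>?Q\<close>; the shared zeros \<open>?C\<close> then add the same
  amount to both counts.\<close>

lemma S_interlaces: "interlaces (S n) (S (Suc n))"
proof -
  let ?P = "Z (Suc n) - Z n" and ?Q = "Z n - Z (Suc n)" and ?C = "Z n \<inter> Z (Suc n)"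
  have fin: "finite ?P" "finite ?Q" "finite ?C" using finite_Z by auto
  have count: "card {x\<in>Z (Suc n). t < x} = card {x\<in>?P. t < x} + card {x\<in>?C. t < x}"
    "card {x\<in>Z n. t < x} = card {x\<in>?Q. t < x} + card {x\<in>?C. t < x}" for t
    using card_filter_Diff_Int[OF finite_Z, of "Suc n" "\<lambda>x. t < x" "Z n"]
      card_filter_Diff_Int[OF finite_Z, of n "\<lambda>x. t < x" "Z (Suc n)"]
    unfolding Int_commute[of "Z (Suc n)"] .
  have cards: "card (Z (Suc n)) = Suc n" "card (Z n) = n" by (simp_all add: card_Z splits)
  have "card (Z (Suc n)) = card ?P + card ?C" "card (Z n) = card ?Q + card ?C"
    using card_Int_Diff[OF finite_Z, of "Suc n" "Z n"] card_Int_Diff[OF finite_Z, of n "Z (Suc n)"]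
    by (simp_all add: Int_commute)
  then have "card ?P = card ?Q + 1" using cards by linarith
  note above = card_above_separated[OF fin(1,2) this separated]
  have above': "card {x\<in>Z (Suc n). t < x} \<le> card {x\<in>Z n. t < x} + 1"
    "card {x\<in>Z n. t < x} \<le> card {x\<in>Z (Suc n). t < x}" for t
    using above[of t] by (auto simp: count)
  have zd: "zeros_desc (S m) = rev (sorted_list_of_set (Z m))" for m
    using zeros_desc_split_poly[OF finite_Z, of "lc m" m] lc_pos[of m]
    by (simp flip: splits_S[OF splits])
  show ?thesis
    unfolding interlaces_def zd degree_S
    using S_real_rooted sorted_interlace[OF finite_Z finite_Z _ _ above'] cards by auto
qed

text \<open>For nonnegative \<open>lam\<close> this bound yields weak stability.\<close>

lemma Re_turan_zero:
  assumes "poly (map_poly of_real (S (n + 2) * S n - (S (n + 1))\<^sup>2)) z = (0 :: complex)"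
  shows "Re z \<le> - lam"
proof (rule ccontr)
  assume "\<not> ?thesis"
  then have Re: "0 < Re z + lam" by simp
  have Re_s: "0 < Re (z - of_real s)" "s \<noteq> Re z" if "s \<in> Z n" for s
    using splits_in_range[OF splits that] Re by (auto simp: in_range_def)
  then have z: "z \<notin> of_real ` Z n" by force
  let ?w = "\<Sum>s\<in>Z n. of_real (poly A s) / (z - of_real s)\<^sup>2"
  let ?D = "of_real (b1 + b2 + real n * b1) - ?w"
  \<comment> \<open>Expanding \<open>S (n + 2)\<close> and one factor \<open>S (n + 1)\<close> by
    the recurrence makes the B terms cancel.\<close>
  have "S (n + 2) * S n - (S (n + 1))\<^sup>2 =
     A * (pderiv (S (Suc n)) * S n - S (Suc n) * pderiv (S n))"
    using T_poly_Suc[of lam a1 a2 b1 b2 "Suc n"] T_poly_Suc[of lam a1 a2 b1 b2 n]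
    by (simp add: power2_eq_square algebra_simps)
  then have "poly (map_poly of_real A) z * ((poly (map_poly of_real (S n)) z)\<^sup>2 * ?D) = 0"
    using assms wronskian[OF splits z] by (simp add: map_poly_of_real_mult)
  moreover have "poly (map_poly of_real A) z \<noteq> 0"
  proof -
    have "0 < Re (of_real b1 * (z + of_real lam) + of_real a1)"
      using Re b1 a1 by (simp add: add_nonneg_pos)
    then have "of_real b1 * (z + of_real lam) + of_real a1 \<noteq> 0" by (metis less_irrefl zero_complex.sel(1))
    moreover have "z + of_real lam \<noteq> 0" using Re by (auto simp: complex_eq_iff)
    ultimately show ?thesis by (simp add: poly_quad_coef)
  qed
  moreover have "poly (map_poly of_real (S n)) z \<noteq> 0"
    using S_complex_zero_iff[OF splits] z by blast
  ultimately have D: "?D = 0" by simp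
  have "Im (of_real (poly A s) / (z - of_real s)\<^sup>2) =
      - 2 * Im z * (poly A s * (Re (z - of_real s) / (cmod (z - of_real s)) ^ 4))" for s
    using Im_of_real_divide_power2[of "poly A s" "z - of_real s"] by simp
  then have "Im ?w = - 2 * Im z * (\<Sum>s\<in>Z n. poly A s * (Re (z - of_real s) / (cmod (z - of_real s)) ^ 4))"
    by (simp add: sum_distrib_left)
  moreover have "Im ?w = 0" using arg_cong[OF D, of Im] by simp
  \<comment> \<open>If z is real, \<open>?D\<close> is a positive derivative. Otherwise a sum of
    terms of one sign vanishes, so every A(s) is 0 and \<open>?D\<close> reduces to the positive
    slope.\<close>
  ultimately consider "Im z = 0"
    | "(\<Sum>s\<in>Z n. poly A s * (Re (z - of_real s) / (cmod (z - of_real s)) ^ 4)) = 0"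
    by auto
  then show False
  proof cases
    case 1
    then have "z = of_real (Re z)" by (simp add: complex_eq_iff)
    then have "?D = of_real (b1 + b2 + real n * b1 - (\<Sum>s\<in>Z n. poly A s / (Re z - s)\<^sup>2))"
      by (metis (no_types, lifting) of_real_diff of_real_divide of_real_power of_real_sum sum.cong)
    then show False
      using D psi_deriv_pos[of "Z n" "Re z"] splits_in_range[OF splits]
      by (metis card_Z less_irrefl of_real_eq_0_iff splits)
  next
    case 2
    have nonneg: "0 \<le> - (poly A s * (Re (z - of_real s) / (cmod (z - of_real s)) ^ 4))"
      if "s \<in> Z n" for s
    proof -
      have "poly A s \<le> 0" using in_range_A splits_in_range[OF splits that] .
      moreover have "0 \<le> Re (z - of_real s) / (cmod (z - of_real s)) ^ 4"
        using Re_s(1)[OF that] by (intro divide_nonneg_nonneg) auto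
      ultimately show ?thesis by (simp only: neg_0_le_iff_le mult_nonpos_nonneg)
    qed
    from 2 have "(\<Sum>s\<in>Z n. - (poly A s * (Re (z - of_real s) / (cmod (z - of_real s)) ^ 4))) = 0"
      by (simp only: sum_negf neg_equal_0_iff_equal)
    then have "\<forall>s\<in>Z n. poly A s * (Re (z - of_real s) / (cmod (z - of_real s)) ^ 4) = 0"
      using sum_nonneg_eq_0_iff[OF finite_Z nonneg] by (simp only: neg_equal_0_iff_equal)
    then have "\<forall>s\<in>Z n. poly A s = 0"
      using Re_s by force
    then show False using D slope_pos[of n]
      by (simp del: of_real_add of_real_mult of_real_of_nat_eq)
  qed
qed

text \<open>An end point can be a zero only if B vanishes there. At \<open>- lam\<close> the value
  of B is a2; at the left end b1 B is b1 a2 - a1 (b1 + b2).\<close>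

lemma S_zero_location:
  assumes "0 < n" "poly (S n) x = 0"
  shows "left_end lam a1 b1 < ereal x \<and> x < - lam \<or> a2 = 0 \<and> x = - lam \<or>
    a1 * (b1 + b2) = b1 * a2 \<and> ereal x = left_end lam a1 b1"
proof -
  have range: "x + lam \<le> 0" "0 \<le> b1 * (x + lam) + a1"
    using splits_in_range[OF splits, of x n] assms(2) by (auto simp: Z_def in_range_def)
  have B0: "poly B x = 0" if "(x + lam) * (b1 * (x + lam) + a1) = 0"
    using poly_T_poly_at_quad_root[of lam a1 b1 x a2 b2 n] that assms
    by (simp add: poly_quad_coef_real)
  have Bx: "poly B x = (b1 + b2) * (x + lam) + a2" by (simp add: lin_coef_def algebra_simps)
  have right: "x < - lam \<or> a2 = 0 \<and> x = - lam"
  proof (cases "x = - lam")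
    case True
    then show ?thesis using B0 unfolding Bx by simp
  qed (use range in auto)
  show ?thesis
  proof (cases "b1 * (x + lam) + a1 = 0")
    case True
    then have b1': "b1 \<noteq> 0" using a1 by auto
    then have x: "x = - lam - a1 / b1" using True by (simp add: field_simps)
    have "b1 * poly B x = (b1 + b2) * (b1 * (x + lam) + a1) - (a1 * (b1 + b2) - b1 * a2)"
      by (simp add: Bx algebra_simps)
    then show ?thesis using x b1' B0 True by (simp add: left_end_def)
  next
    case False
    have "left_end lam a1 b1 < ereal x"
    proof (cases "b1 = 0")
      case False
      then have "0 < b1" "0 < b1 * (x + lam) + a1"
        using \<open>b1 * (x + lam) + a1 \<noteq> 0\<close> range b1 by auto
      then show ?thesis by (simp add: left_end_def field_simps)
    qed (simp add: left_end_def)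
    then show ?thesis using right by auto
  qed
qed

end

subsection \<open>Log-concavity\<close>

text \<open>Log-concavity without internal zeros; unlike plain log-concavity, it is inherited by products.\<close>

definition pf2 :: "real poly \<Rightarrow> bool" where
  "pf2 p \<longleftrightarrow> (\<forall>k. 0 \<le> coeff p k) \<and>
     (\<forall>i j. i \<le> j \<longrightarrow> coeff p i * coeff p (j + 2) \<le> coeff p (i + 1) * coeff p (j + 1))"

lemma pf2_log_concave:
  assumes "pf2 p"
  shows "log_concave (coeff p)"
  unfolding log_concave_def
proof (intro conjI allI impI)
  fix k :: nat assume "1 \<le> k"
  then obtain i where "k = Suc i" by (cases k) auto
  then show "coeff p (k - 1) * coeff p (k + 1) \<le> (coeff p k)\<^sup>2"
    using assms by (auto simp: pf2_def power2_eq_square)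
qed (use assms in \<open>auto simp: pf2_def\<close>)

lemma pf2_smult:
  assumes "pf2 p" "0 \<le> c"
  shows "pf2 (smult c p)"
proof -
  have "c * coeff p i * (c * coeff p (j + 2)) \<le> c * coeff p (i + 1) * (c * coeff p (j + 1))"
    if "i \<le> j" for i j
    using mult_left_mono[of "coeff p i * coeff p (j + 2)" "coeff p (i + 1) * coeff p (j + 1)" "c * c"]
      assms that by (simp add: pf2_def mult_ac)
  then show ?thesis using assms by (simp add: pf2_def)
qed

lemma pf2_1: "pf2 1"
  by (simp add: pf2_def)

text \<open>The two products are compared coefficientwise in powers of \<open>c\<close>. The terms
  for c^2 and 1 are instances of the hypothesis; for c, one summand is common and the other follows
  by chaining two instances, the second of which is trivial for \<open>i = j\<close>.\<close>

lemma pf2_mult_linear: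
  assumes "pf2 p" "0 \<le> c"
  shows "pf2 ([:c, 1:] * p)"
proof -
  let ?a = "coeff p" and ?d = "coeff ([:c, 1:] * p)"
  have d: "?d 0 = c * ?a 0" "\<And>k. ?d (Suc k) = c * ?a (Suc k) + ?a k" by auto
  have a: "0 \<le> ?a k" "i \<le> j \<Longrightarrow> ?a i * ?a (Suc (Suc j)) \<le> ?a (Suc i) * ?a (Suc j)" for i j k
    using assms(1) by (auto simp: pf2_def)
  have c2: "c * c * (?a i * ?a (Suc (Suc j))) \<le> c * c * (?a (Suc i) * ?a (Suc j))" if "i \<le> j" for i j
    using a(2)[OF that] assms(2) by (intro mult_left_mono) auto
  have "?d i * ?d (Suc (Suc j)) \<le> ?d (Suc i) * ?d (Suc j)" if "i \<le> j" for i j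
  proof (cases i)
    case 0
    have "0 \<le> c * (?a (Suc 0) * ?a j')" "0 \<le> ?a 0 * ?a j'" for j' using assms(2) a(1) by simp_all
    then show ?thesis
      using c2[of 0 j] assms(2) a(1) unfolding 0 d
      by (cases j) (auto simp: d algebra_simps add_increasing)
  next
    case (Suc i')
    with that obtain j' where j: "j = Suc j'" "i' \<le> j'" by (metis Suc_le_D Suc_le_mono)
    have 1: "?a i' * ?a (Suc j) \<le> ?a i * ?a j" using a(2)[of i' j'] j Suc by simp
    have 2: "?a i' * ?a (Suc (Suc j)) \<le> ?a i * ?a (Suc j)"
      using a(2)[of i' j] j Suc by simp
    have 3: "?a i * ?a (Suc j) \<le> ?a (Suc i) * ?a j"
    proof (cases "i \<le> j'")
      case True
      then show ?thesis using a(2)[of i j'] j by simp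
    next
      case False
      then have "i = j" using that j by simp
      then show ?thesis by simp
    qed
    have "c * (?a i' * ?a (Suc (Suc j))) \<le> c * (?a (Suc i) * ?a j)"
      using 2 3 assms(2) by (intro mult_left_mono) auto
    then show ?thesis
      using c2[OF that] 1 unfolding Suc j(1) d by (simp add: algebra_simps)
  qed
  moreover have "0 \<le> ?d k" for k using a(1) assms(2) by (cases k) (auto simp: d)
  ultimately show ?thesis by (simp add: pf2_def)
qed

lemma pf2_split_poly:
  assumes "0 \<le> k" "\<And>s. s \<in> R \<Longrightarrow> s \<le> 0"
  shows "pf2 (split_poly k R)"
proof -
  have "pf2 (\<Prod>s\<in>R. [:- s, 1:])"
    using assms(2)
    by (induction R rule: infinite_finite_induct)
       (auto simp: pf2_1 simp del: mult_pCons_left intro!: pf2_mult_linear)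
  then show ?thesis unfolding split_poly_def using assms(1) by (rule pf2_smult)
qed

lemma pf2_linear_power: "0 \<le> c \<Longrightarrow> pf2 ([:c, 1:] ^ n)"
  by (induction n) (auto simp: pf2_1 simp del: mult_pCons_left intro!: pf2_mult_linear)

text \<open>For b1 = b2 = 0 nothing passes from \<open>k - 1\<close> to \<open>k\<close>, so the
  support stays at index 0.\<close>

lemma T_eq_0_of_b_eq_0: "0 < k \<Longrightarrow> T lam a1 a2 0 0 n k = 0"
  by (induction n arbitrary: k) auto

lemma log_concave_of_b_eq_0:
  assumes "0 \<le> a2"
  shows "log_concave (\<lambda>k. T lam a1 a2 0 0 n (int k))"
proof -
  have "0 \<le> T lam a1 a2 0 0 n 0"
    using assms by (induction n) (auto simp: T_eq_0_of_b_eq_0)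
  then have "0 \<le> T lam a1 a2 0 0 n (int k)" for k
    by (cases "k = 0") (auto simp: T_eq_0_of_b_eq_0)
  then show ?thesis by (auto simp: log_concave_def T_eq_0_of_b_eq_0)
qed

subsection \<open>The degenerate case a1 = 0\<close>

text \<open>B is a multiple of x - r. If b1 is nonzero, then a2 = 0, r = - lam and A = b1 (x - r)^2;
  if b1 = 0, then A = 0. Either way one step of the recurrence multiplies by a constant and x -
  r.\<close>

lemma T_poly_of_a1_eq_0:
  fixes lam a2 b1 b2 :: real
  assumes "0 < b1 + b2" "b1 * a2 = 0"
  defines "r \<equiv> - lam - a2 / (b1 + b2)"
  shows "T_poly lam 0 a2 b1 b2 n = smult (T lam 0 a2 b1 b2 n (int n)) ([:- r, 1:] ^ n)"
proof (induction n)
  case (Suc n)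
  let ?p = "[:- r, 1:]" and ?c = "T lam 0 a2 b1 b2 n (int n)"
  have B: "lin_coef lam a2 b1 b2 = smult (b1 + b2) ?p"
    using assms(1) by (simp add: lin_coef_def r_def field_simps)
  have A: "quad_coef lam 0 b1 * pderiv (?p ^ n) = smult (b1 * real n) (?p ^ Suc n)"
  proof (cases "b1 = 0")
    case False
    then have "[:lam, 1:] = ?p" using assms(2) by (simp add: r_def)
    moreover have "[:b1 * lam, b1:] = smult b1 [:lam, 1:]" by simp
    ultimately have "quad_coef lam 0 b1 = smult b1 (?p * ?p)" by (simp add: quad_coef_def del: mult_pCons_left)
    moreover have "?p * pderiv (?p ^ n) = smult (real n) (?p ^ n)"
      by (cases n) (simp_all add: pderiv_power_Suc pderiv_pCons del: mult_pCons_left power_Suc, simp add: mult.commute)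
    ultimately show ?thesis
      by (simp only: mult_smult_left mult_smult_right mult.assoc smult_smult power_Suc)
  qed (simp add: quad_coef_def)
  have "T_poly lam 0 a2 b1 b2 (Suc n) =
      smult ?c (quad_coef lam 0 b1 * pderiv (?p ^ n)) + smult ?c (smult (b1 + b2) (?p ^ Suc n))"
    unfolding T_poly_Suc Suc B
    by (simp only: pderiv_smult mult_smult_left mult_smult_right power_Suc smult_smult mult.commute)
  also have "\<dots> = smult ((b1 * real (Suc n) + b2) * ?c) (?p ^ Suc n)"
    unfolding A by (simp add: algebra_simps flip: smult_add_left del: mult_pCons_left power_Suc)
  finally show ?case by (simp only: T_diag_Suc)
qed simp

lemma poly_linear_power_eq_0D:
  assumes "k \<noteq> 0" "poly (map_poly of_real (smult k ([:- r, 1:] ^ n))) z = (0 :: 'a::real_normed_field)"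
  shows "z = of_real r"
  using assms by (auto simp: map_poly_of_real_simps)

lemma zeros_desc_linear_power:
  assumes "k \<noteq> 0"
  shows "zeros_desc (smult k ([:- r, 1:] ^ n)) = replicate n r"
proof -
  have "sorted_list_of_multiset (mset (replicate n r)) = sort (replicate n r)"
    by (rule sorted_list_of_multiset_mset)
  also have "\<dots> = replicate n r" by (rule sort_key_id_if_sorted) (induction n, auto)
  finally have "sorted_list_of_multiset (replicate_mset n r) = replicate n r" by simp
  moreover have "repeat_mset n {#r#} = replicate_mset n r" by (induction n) auto
  ultimately show ?thesis using assms by (simp add: zeros_desc_def proots_power)
qed

lemma real_rooted_linear_power: "k \<noteq> 0 \<Longrightarrow> real_rooted (smult k ([:- r, 1:] ^ n))"
  unfolding real_rooted_def using poly_linear_power_eq_0D[where 'a = complex]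
  by (metis Reals_of_real)

lemma interlaces_linear_power:
  assumes "k \<noteq> 0" "k' \<noteq> 0"
  shows "interlaces (smult k ([:- r, 1:] ^ n)) (smult k' ([:- r, 1:] ^ Suc n))"
  unfolding interlaces_def zeros_desc_linear_power[OF assms(1)] zeros_desc_linear_power[OF assms(2)]
  using assms real_rooted_linear_power by (auto simp: degree_power_eq simp del: power_Suc replicate_Suc)

lemma turan_linear_power:
  fixes r :: real
  shows "smult k ([:- r, 1:] ^ (n + 2)) * smult k' ([:- r, 1:] ^ n) - (smult k'' ([:- r, 1:] ^ (n + 1)))\<^sup>2
     = smult (k * k' - k''\<^sup>2) ([:- r, 1:] ^ (2 * n + 2))"
  by (simp only: smult_diff_left power2_eq_square mult_smult_left mult_smult_right smult_smult
      flip: power_add) (simp add: mult_2 mult_2_right mult.commute del: power_Suc)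

section \<open>Assembly of the cases b1 + b2 = 0, a1 = 0 and a1 > 0\<close>

lemma log_concave_T:
  assumes "0 \<le> lam" "0 \<le> a1" "0 \<le> a2" "0 \<le> b1" "0 \<le> b2" "b1 * a2 \<le> a1 * (b1 + b2)"
  shows "log_concave (\<lambda>k. T lam a1 a2 b1 b2 n (int k))"
proof (cases "b1 + b2 = 0")
  case True
  then have "b1 = 0" "b2 = 0" using assms by auto
  then show ?thesis using log_concave_of_b_eq_0 assms by simp
next
  case False
  then have b: "0 < b1 + b2" using assms by simp
  note lc_pos = T_diag_pos[OF assms(4,5) b, of lam a1 a2 n]
  have "pf2 (T_poly lam a1 a2 b1 b2 n)"
  proof (cases "a1 = 0")
    case True
    have "b1 * a2 = 0" using assms True by (intro antisym) auto
    then show ?thesis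
      using T_poly_of_a1_eq_0[OF b, of a2 lam n] lc_pos assms b True
      by (auto intro!: pf2_smult pf2_linear_power)
  next
    case False
    interpret tri_params lam a1 a2 b1 b2 using assms b False by unfold_locales auto
    have "s \<le> 0" if "s \<in> Z n" for s
      using splits_in_range[OF splits that] assms(1) by (simp add: in_range_def)
    then show ?thesis
      unfolding splits_S[OF splits] using lc_pos[of n] by (intro pf2_split_poly) auto
  qed
  then show ?thesis using pf2_log_concave by (fastforce simp: coeff_T_poly[abs_def])
qed

text \<open>The side conditions mark degenerate parameters. For b1 = b2 = 0 all polynomials are
  constant; for a1 = 0 they are multiples of (x - r)^n; for a2 = 0 the point - lam is a zero;
  equality in the hypothesis with b1 > 0 makes the left end a zero. For a1 = b1 = 0 the Turan
  polynomial is 0, which does not count as weakly stable.\<close>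

theorem theorem3p2:
  fixes lam a1 a2 b1 b2 :: real
  assumes "0 \<le> lam" and "0 \<le> a1" and "0 \<le> a2" and "0 \<le> b1" and "0 \<le> b2"
    and "a1 * (b1 + b2) \<ge> b1 * a2"
  shows "(\<forall>n\<ge>1.
           (b1 + b2 > 0 \<longrightarrow>
              real_rooted (T_poly lam a1 a2 b1 b2 n) \<and>
              (a1 > 0 \<longrightarrow> simple_zeros (T_poly lam a1 a2 b1 b2 n)) \<and>
              (\<forall>x::real. poly (T_poly lam a1 a2 b1 b2 n) x = 0 \<longrightarrow>
                 left_end lam a1 b1 < ereal x \<and> x < - lam \<or>
                 a2 = 0 \<and> x = - lam \<or>
                 a1 * (b1 + b2) = b1 * a2 \<and> ereal x = left_end lam a1 b1) \<and>
              interlaces (T_poly lam a1 a2 b1 b2 (n - 1)) (T_poly lam a1 a2 b1 b2 n)) \<and>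
           log_concave (\<lambda>k. T lam a1 a2 b1 b2 n (int k)))
       \<and> (\<forall>n\<ge>1. b1 + b2 > 0 \<and> (a1 > 0 \<or> b1 > 0) \<longrightarrow>
           weakly_stable (T_poly lam a1 a2 b1 b2 (n + 1) * T_poly lam a1 a2 b1 b2 (n - 1)
                          - (T_poly lam a1 a2 b1 b2 n)\<^sup>2))"
proof (intro conjI allI impI)
  fix n :: nat assume n: "1 \<le> n"
  show "log_concave (\<lambda>k. T lam a1 a2 b1 b2 n (int k))"
    using log_concave_T assms by blast
  assume b: "0 < b1 + b2"
  let ?r = "- lam - a2 / (b1 + b2)"
  note lc = T_diag_pos[OF assms(4,5) b, of lam a1 a2]
  have a1_0: "T_poly lam a1 a2 b1 b2 m =
      smult (T lam a1 a2 b1 b2 m (int m)) ([:- ?r, 1:] ^ m)" "b1 * a2 = 0" if "a1 = 0" for m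
  proof -
    show "b1 * a2 = 0" using assms that by (intro antisym) auto
    then show "T_poly lam a1 a2 b1 b2 m = smult (T lam a1 a2 b1 b2 m (int m)) ([:- ?r, 1:] ^ m)"
      using T_poly_of_a1_eq_0[OF b] that by simp
  qed
  have params: "tri_params a1 a2 b1 b2" if "a1 \<noteq> 0"
    using assms b that by unfold_locales auto
  obtain m where m: "n = Suc m" using n by (cases n) auto
  show "real_rooted (T_poly lam a1 a2 b1 b2 n)"
    using a1_0(1) real_rooted_linear_power lc tri_params.S_real_rooted[OF params]
    by (metis less_irrefl)
  show "simple_zeros (T_poly lam a1 a2 b1 b2 n)" if "0 < a1"
    using tri_params.S_simple_zeros[OF params] that by simp
  show "interlaces (T_poly lam a1 a2 b1 b2 (n - 1)) (T_poly lam a1 a2 b1 b2 n)"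
  proof (cases "a1 = 0")
    case True
    show ?thesis
      unfolding m a1_0(1)[OF True] diff_Suc_1
      using lc[of m] lc[of "Suc m"] by (intro interlaces_linear_power) (auto simp del: T.simps)
  next
    case False
    then show ?thesis using tri_params.S_interlaces[OF params] m by simp
  qed
  fix x assume x: "poly (T_poly lam a1 a2 b1 b2 n) x = 0"
  show "left_end lam a1 b1 < ereal x \<and> x < - lam \<or> a2 = 0 \<and> x = - lam \<or>
    a1 * (b1 + b2) = b1 * a2 \<and> ereal x = left_end lam a1 b1"
  proof (cases "a1 = 0")
    case True
    have "x = ?r" using x lc[of n] unfolding a1_0(1)[OF True] by (auto simp del: T.simps)
    \<comment> \<open>If a2 = 0 then \<open>?r\<close> is - lam. Otherwise b1 = 0, so the left end
      is minus infinity and \<open>?r\<close> lies strictly below - lam.\<close>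
    then show ?thesis
      using a1_0(2)[OF True] assms(3) b
      by (cases "a2 = 0") (auto simp: left_end_def)
  next
    case False
    then show ?thesis using tri_params.S_zero_location[OF params _ x] n by simp
  qed
next
  fix n :: nat assume n: "1 \<le> n" and ab: "b1 + b2 > 0 \<and> (a1 > 0 \<or> b1 > 0)"
  obtain m where m: "n = Suc m" using n by (cases n) auto
  note lc = T_diag_pos[OF assms(4,5), of lam a1 a2]
  show "weakly_stable (T_poly lam a1 a2 b1 b2 (n + 1) * T_poly lam a1 a2 b1 b2 (n - 1)
                          - (T_poly lam a1 a2 b1 b2 n)\<^sup>2)"
  proof (cases "a1 = 0")
    case False
    then interpret tri_params lam a1 a2 b1 b2 using assms ab by unfold_locales auto
    show ?thesis
      unfolding weakly_stable_def using Re_turan_zero[of m] assms(1) m by fastforce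
  next
    case True
    let ?r = "- lam - a2 / (b1 + b2)" and ?t = "\<lambda>m. T lam a1 a2 b1 b2 m (int m)"
    have "b1 * a2 = 0" using assms True by (intro antisym) auto
    then have eq: "T_poly lam a1 a2 b1 b2 m = smult (?t m) ([:- ?r, 1:] ^ m)" for m
      using T_poly_of_a1_eq_0 ab True by simp
    have t: "?t (Suc m) = (b1 * real (Suc m) + b2) * ?t m" for m by (rule T_diag_Suc)
    \<comment> \<open>The factors taking \<open>?t m\<close> to \<open>?t (m + 1)\<close> and on to
      \<open>?t (m + 2)\<close> differ by b1, which is positive here because a1 = 0.\<close>
    have "?t (m + 2) * ?t m - (?t (m + 1))\<^sup>2 = ?t m * ?t (Suc m) * b1"
      using t[of m] t[of "Suc m"]
      by (simp del: T.simps add: algebra_simps power2_eq_square)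
    moreover have "\<dots> \<noteq> 0" using lc[of m] lc[of "Suc m"] ab True by (auto simp del: T.simps)
    ultimately have "?t (m + 2) * ?t m - (?t (m + 1))\<^sup>2 \<noteq> 0" by simp
    from poly_linear_power_eq_0D[OF this, of ?r "2 * m + 2", where 'a = complex]
    have "Re z = ?r" if "poly (map_poly of_real (smult (?t (m + 2) * ?t m - (?t (m + 1))\<^sup>2)
        ([:- ?r, 1:] ^ (2 * m + 2)))) z = (0 :: complex)" for z
      using that by (metis Re_complex_of_real)
    moreover have "?r \<le> 0"
    proof -
      have "0 \<le> a2 / (b1 + b2)" using assms(3) ab by (intro divide_nonneg_pos) auto
      then show ?thesis using assms(1) by linarith
    qed
    moreover have "T_poly lam a1 a2 b1 b2 (m + 2) * T_poly lam a1 a2 b1 b2 m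
          - (T_poly lam a1 a2 b1 b2 (m + 1))\<^sup>2 = smult (?t (m + 2) * ?t m - (?t (m + 1))\<^sup>2)
        ([:- ?r, 1:] ^ (2 * m + 2))"
      unfolding eq by (rule turan_linear_power)
    moreover have "n + 1 = m + 2" "n - 1 = m" "n = m + 1" using m by simp_all
    ultimately show ?thesis unfolding weakly_stable_def by metis
  qed
qed

end
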